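(* Let $N\in\mathbb N\cup\{\infty\}$, let $(c_k)_{k\in\mathbb N}$ be pairwise coprime odd integers greater than $1$, and let $$\mathcal B=\mathcal B_1^N=\{2^kc_k:k\in\mathbb N\}\cup\{2^{k-1}c_k^2:k\in\mathbb N,\ k<N\}.$$ Then for each $1\le\ell<N$ ($\ell\in\mathbb N$), the map $F_\ell$ (defined in the context) belongs to the centralizer of the $\mathcal B_1^N$-free subshift $(X_\eta,\sigma)$. It satisfies $F_\ell^{c_\ell}=\operatorname{id}_{X_\eta}$, but $F_\ell^i\ne\operatorname{id}_{X_\eta}$ for all $1\le i<c_\ell$.
   Context: $\mathbb N=\{1,2,\dots\}$. $\eta\in\{0,1\}^{\mathbb Z}$ is the characteristic function of $\mathcal F_{\mathcal B}=\mathbb Z\setminus\bigcup_{b\in\mathcal B}b\mathbb Z$; $\sigma$ is the left shift and the $\mathcal B$-free subshift $X_\eta$ is the orbit closure of $\eta$. The centralizer is the group of homeomorphisms of $X_\eta$ commuting with $\sigma$. Let $S_n=\{2^kc_k:k\le n\}\cup\{2^{k-1}c_k^2:k\le\min\{n,N-1\}\}$ and $p_n=\operatorname{lcm}(S_n)$; then $(p_n)$ is a period structure of the Toeplitz sequence $\eta$, and $G=\varprojlim\mathbb Z/p_n\mathbb Z$ with translation by $\Delta(1)$, where $\Delta(k)=(k+p_n\mathbb Z)_n$, is the maximal equicontinuous factor of $(X_\eta,\sigma)$, with factor map $\pi:X_\eta\to G$ determined by $\pi(\eta)=\Delta(0)$. Denote by $\pi_{\operatorname{lcm}(S_\ell)}(x)\in\mathbb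 Z/p_\ell\mathbb Z$ the $\ell$-th coordinate of $\pi(x)$. For $1\le\ell<N$ we have $p_\ell=2^\ell c_1^2\cdots c_\ell^2$. Put $q=p_\ell/c_\ell=2^\ell c_1^2\cdots c_{\ell-1}^2c_\ell$ and define $F_\ell:X_\eta\to\{0,1\}^{\mathbb Z}$ by $$(F_\ell x)_s=\begin{cases}x_s&\text{if }s\notin c_\ell\mathbb Z-\pi_{\operatorname{lcm}(S_\ell)}(x),\\ x_{s+q}&\text{if }s\in c_\ell\mathbb Z-\pi_{\operatorname{lcm}(S_\ell)}(x)\end{cases}$$ (well defined since $c_\ell\mid p_\ell$). *)

theory Defs
  imports "HOL-Analysis.Analysis" "HOL-Library.Extended_Nat"
begin

text \<open>The full shift over the alphabet of two symbols is the type \<open>int \<Rightarrow> bool\<close> (\<open>True\<close> for \<open>1\<close>,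
  \<open>False\<close> for \<open>0\<close>), with the library's product topology of the discrete topology.\<close>

definition shift_by :: "int \<Rightarrow> (int \<Rightarrow> 'a) \<Rightarrow> int \<Rightarrow> 'a"
  where "shift_by k x = (\<lambda>s. x (s + k))"

abbreviation left_shift :: "(int \<Rightarrow> 'a) \<Rightarrow> int \<Rightarrow> 'a"
  where "left_shift \<equiv> shift_by 1"

definition orbit_closure :: "(int \<Rightarrow> bool) \<Rightarrow> (int \<Rightarrow> bool) set"
  where "orbit_closure x = closure (range (\<lambda>k. shift_by k x))"

definition free_set :: "nat set \<Rightarrow> int set"
  where "free_set B = UNIV - (\<Union>b\<in>B. {int b * m |m. True})"

definition free_char :: "nat set \<Rightarrow> int \<Rightarrow> bool"
  where "free_char B = (\<lambda>s. s \<in> free_set B)"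

definition free_subshift :: "nat set \<Rightarrow> (int \<Rightarrow> bool) set"
  where "free_subshift B = orbit_closure (free_char B)"

text \<open>Self-maps of \<open>X\<close> are represented by functions that are extensional on \<open>X\<close>, so that equality
  of functions is equality of maps on \<open>X\<close>.\<close>

definition centralizer :: "(int \<Rightarrow> bool) set \<Rightarrow> ((int \<Rightarrow> bool) \<Rightarrow> int \<Rightarrow> bool) set"
  where "centralizer X = {f \<in> extensional X. (\<exists>g. homeomorphism X X f g) \<and>
           (\<forall>x\<in>X. f (left_shift x) = left_shift (f x))}"

definition factor_map ::
    "'a::topological_space set \<Rightarrow> ('a \<Rightarrow> 'a) \<Rightarrow> 'b::topological_space set \<Rightarrow> ('b \<Rightarrow> 'b) \<Rightarrow> ('a \<Rightarrow> 'b) \<Rightarrow> bool"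
  where "factor_map X S Y T \<pi> \<longleftrightarrow>
           continuous_on X \<pi> \<and> \<pi> ` X = Y \<and> (\<forall>x\<in>X. \<pi> (S x) = T (\<pi> x))"

text \<open>The inverse limit of the groups \<open>\<int>/p\<^sub>n\<int>\<close> along the canonical projections, for \<open>p\<^sub>m\<close> dividing
  \<open>p\<^sub>n\<close> whenever \<open>m \<le> n\<close>. A residue class is represented by its least nonnegative element, and the
  topology is that of \<open>nat \<Rightarrow> int\<close> (product of discrete spaces).\<close>

definition odometer :: "(nat \<Rightarrow> nat) \<Rightarrow> (nat \<Rightarrow> int) set"
  where "odometer p = {g. (\<forall>n. g n \<in> {0..<int (p n)}) \<and> (\<forall>m n. m \<le> n \<longrightarrow> g n mod int (p m) = g m)}"

definition odometer_Delta :: "(nat \<Rightarrow> nat) \<Rightarrow> int \<Rightarrow> nat \<Rightarrow> int"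
  where "odometer_Delta p k = (\<lambda>n. k mod int (p n))"

definition odometer_add :: "(nat \<Rightarrow> nat) \<Rightarrow> (nat \<Rightarrow> int) \<Rightarrow> (nat \<Rightarrow> int) \<Rightarrow> nat \<Rightarrow> int"
  where "odometer_add p g h = (\<lambda>n. (g n + h n) mod int (p n))"

text \<open>In the following, \<open>c\<close> is indexed from \<open>1\<close>; the value \<open>c 0\<close> is never used.\<close>

definition B1 :: "enat \<Rightarrow> (nat \<Rightarrow> nat) \<Rightarrow> nat set"
  where "B1 N c = {2 ^ k * c k |k. 1 \<le> k} \<union> {2 ^ (k - 1) * (c k)\<^sup>2 |k. 1 \<le> k \<and> enat k < N}"

definition S1 :: "enat \<Rightarrow> (nat \<Rightarrow> nat) \<Rightarrow> nat \<Rightarrow> nat set"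
  where "S1 N c n = {2 ^ k * c k |k. 1 \<le> k \<and> k \<le> n} \<union>
           {2 ^ (k - 1) * (c k)\<^sup>2 |k. 1 \<le> k \<and> enat k \<le> min (enat n) (N - 1)}"

text \<open>The additional index \<open>n = 0\<close> gives \<open>p\<^sub>0 = 1\<close>, that is, a trivial coordinate of the inverse limit.\<close>

definition period1 :: "enat \<Rightarrow> (nat \<Rightarrow> nat) \<Rightarrow> nat \<Rightarrow> nat"
  where "period1 N c n = Lcm (S1 N c n)"

abbreviation eta1 :: "enat \<Rightarrow> (nat \<Rightarrow> nat) \<Rightarrow> int \<Rightarrow> bool"
  where "eta1 N c \<equiv> free_char (B1 N c)"

abbreviation X1 :: "enat \<Rightarrow> (nat \<Rightarrow> nat) \<Rightarrow> (int \<Rightarrow> bool) set"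
  where "X1 N c \<equiv> free_subshift (B1 N c)"

text \<open>Continuity and equivariance determine the factor map on the closure of the orbit of \<open>\<eta>\<close> from
  its value at \<open>\<eta>\<close>; extensionality fixes it outside.\<close>

definition pi1 :: "enat \<Rightarrow> (nat \<Rightarrow> nat) \<Rightarrow> (int \<Rightarrow> bool) \<Rightarrow> nat \<Rightarrow> int"
  where "pi1 N c = (THE \<pi>. \<pi> \<in> extensional (X1 N c) \<and>
           factor_map (X1 N c) left_shift
             (odometer (period1 N c))
             (odometer_add (period1 N c) (odometer_Delta (period1 N c) 1)) \<pi> \<and>
           \<pi> (eta1 N c) = odometer_Delta (period1 N c) 0)"

definition F1 :: "enat \<Rightarrow> (nat \<Rightarrow> nat) \<Rightarrow> nat \<Rightarrow> (int \<Rightarrow> bool) \<Rightarrow> int \<Rightarrow> bool"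
  where "F1 N c l = (\<lambda>x\<in>X1 N c. \<lambda>s.
           if s \<in> {int (c l) * m - pi1 N c x l |m. True}
           then x (s + int (period1 N c l div c l)) else x s)"

end

theory Submission
  imports Defs "HOL-Number_Theory.Cong"
begin

text \<open>If \<open>2 ^ n\<close> does not divide \<open>s\<close>, only the finitely many elements of \<open>S1 N c n\<close> decide whether \<open>s\<close>
  is free. Hence \<open>\<eta>\<close> is a Toeplitz sequence, and since every progression \<open>d + b\<int>\<close> with \<open>b \<in> B1 N c\<close>
  not dividing \<open>d\<close> contains a free number, a long window of \<open>\<eta>\<close> determines its position modulo each
  period; this gives the factor map. The image \<open>F \<eta>\<close> is the limit of shifts of \<open>\<eta>\<close> by integers that
  converge in the odometer to the element equal to \<open>q\<close> in the \<open>c l\<close>-adic coordinate and to \<open>0\<close> in all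
  others. As \<open>c l\<close> divides \<open>q\<close>, \<open>F\<close> preserves the position modulo \<open>c l\<close>, so \<open>F ^^ i\<close> moves the
  entries in question by \<open>i * q\<close>. The power \<open>c l\<close> moves them by the full period, which \<open>\<eta>\<close> does not
  notice at multiples of \<open>c l\<close>; a smaller power makes the entry at \<open>2 ^ (l - 1) * (c l)\<^sup>2\<close> free.\<close>

section \<open>Orbit closures in the full shift\<close>

text \<open>Windows form a neighbourhood base of the product topology, so topological statements
  become comparisons of finitely many entries. The radius is an integer so that shifts can be added
  to it; a negative radius gives a vacuous condition.\<close>

definition agree :: "int \<Rightarrow> (int \<Rightarrow> 'a) \<Rightarrow> (int \<Rightarrow> 'a) \<Rightarrow> bool"
  where "agree W x y \<longleftrightarrow> (\<forall>s. \<bar>s\<bar> \<le> W \<longrightarrow> x s = y s)"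

lemma agreeD: "agree W x y \<Longrightarrow> \<bar>s\<bar> \<le> W \<Longrightarrow> x s = y s"
  by (simp add: agree_def)

lemma agree_sym: "agree W x y \<Longrightarrow> agree W y x"
  by (simp add: agree_def)

lemma agree_trans: "agree W x y \<Longrightarrow> agree W y z \<Longrightarrow> agree W x z"
  by (simp add: agree_def)

lemma agree_mono: "agree W x y \<Longrightarrow> V \<le> W \<Longrightarrow> agree V x y"
  by (simp add: agree_def)

lemma agree_shift: "agree (W + \<bar>k\<bar>) x y \<Longrightarrow> agree W (shift_by k x) (shift_by k y)"
  by (auto simp: agree_def shift_by_def)

lemma shift_by_shift_by [simp]: "shift_by j (shift_by k x) = shift_by (j + k) x"
  by (simp add: shift_by_def algebra_simps)

lemma shift_by_0 [simp]: "shift_by 0 x = x"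
  by (simp add: shift_by_def)

section \<open>Windows, continuity and convergence\<close>

lemma open_agree:
  fixes x :: "int \<Rightarrow> 'a::discrete_topology"
  shows "open {y. agree W x y}"
proof -
  have "{s. \<bar>s\<bar> \<le> W} = {-W..W}" by auto
  then have "open {y. \<forall>s\<in>{s. \<bar>s\<bar> \<le> W}. y (id s) \<in> {v. x s = v}}"
    by (intro product_topology_basis'[where x = id and U = "\<lambda>s. {v. x s = v}"])
      (simp_all add: open_discrete)
  then show ?thesis unfolding agree_def Ball_def mem_Collect_eq id_apply .
qed

text \<open>Windows are open, so \<open>f\<close> is locally constant on \<open>X\<close>; this
  suffices for any topology on the target.\<close>

lemma continuous_on_if_window:
  fixes f :: "(int \<Rightarrow> 'a::discrete_topology) \<Rightarrow> 'b::topological_space"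
  assumes "\<And>x. x \<in> X \<Longrightarrow> \<exists>W. \<forall>y\<in>X. agree W x y \<longrightarrow> f y = f x"
  shows "continuous_on X f"
  unfolding continuous_on_def
proof
  fix x assume x: "x \<in> X"
  then obtain W where W: "\<And>y. y \<in> X \<Longrightarrow> agree W x y \<Longrightarrow> f y = f x"
    using assms by blast
  have "x \<in> {y. agree W x y}" by (simp add: agree_def)
  then have "\<forall>\<^sub>F y in at x within X. f y = f x"
    using open_agree[of W x] W unfolding eventually_at_topological by blast
  then show "(f \<longlongrightarrow> f x) (at x within X)" by (rule tendsto_eventually)
qed

lemma tendsto_fun:
  fixes f :: "'b \<Rightarrow> 'c \<Rightarrow> 'a::topological_space"
  assumes "\<And>i. ((\<lambda>n. f n i) \<longlongrightarrow> g i) F"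
  shows "(f \<longlongrightarrow> g) F"
  using assms limitin_componentwise[of "\<lambda>_. euclidean" UNIV f g F]
  by (simp add: euclidean_product_topology)

text \<open>One direction holds because windows are open. For the other, shifts that match
  \<open>x\<close> on windows of radius \<open>n\<close> converge to \<open>x\<close>
  coordinatewise.\<close>

lemma orbit_closure_iff:
  "x \<in> orbit_closure z \<longleftrightarrow> (\<forall>W. \<exists>k. agree W x (shift_by k z))"
proof
  assume x: "x \<in> orbit_closure z"
  show "\<forall>W. \<exists>k. agree W x (shift_by k z)"
  proof
    fix W
    have "x \<in> {y. agree W x y}" by (simp add: agree_def)
    then have "range (\<lambda>k. shift_by k z) \<inter> {y. agree W x y} \<noteq> {}"
      using x open_agree[of W x] unfolding orbit_closure_def
      by (metis closure_iff_nhds_not_empty order_refl)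
    then show "\<exists>k. agree W x (shift_by k z)" by auto
  qed
next
  assume "\<forall>W. \<exists>k. agree W x (shift_by k z)"
  then obtain k where k: "\<And>W. agree W x (shift_by (k W) z)" by metis
  have "(\<lambda>n. shift_by (k (int n)) z) \<longlonglongrightarrow> x"
  proof (rule tendsto_fun, rule tendsto_eventually)
    fix s
    show "\<forall>\<^sub>F n in sequentially. shift_by (k (int n)) z s = x s"
      using eventually_ge_at_top[of "nat \<bar>s\<bar>"]
      by eventually_elim (metis agreeD k nat_le_iff)
  qed
  then show "x \<in> orbit_closure z"
    unfolding orbit_closure_def
    by (rule Lim_in_closed_set[rotated 3])
      (auto intro!: always_eventually closure_subset[THEN subsetD])
qed

lemma shift_by_in_orbit_closure: "shift_by k z \<in> orbit_closure z"
  by (auto simp: orbit_closure_iff agree_def)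

lemma orbit_closure_shift_by:
  assumes "x \<in> orbit_closure z"
  shows "shift_by j x \<in> orbit_closure z"
  unfolding orbit_closure_iff
proof
  fix W
  obtain k where "agree (W + \<bar>j\<bar>) x (shift_by k z)"
    using assms by (auto simp: orbit_closure_iff)
  then show "\<exists>k. agree W (shift_by j x) (shift_by k z)"
    using agree_shift by fastforce
qed

lemma compact_orbit_closure: "compact (orbit_closure z)"
proof -
  have "compact_space (product_topology (\<lambda>i::int. euclidean :: bool topology) UNIV)"
    by (simp add: compact_space_product_topology) (simp add: compact_space_def finite_imp_compact)
  then have "compact (UNIV :: (int \<Rightarrow> bool) set)"
    by (simp add: euclidean_product_topology compact_space_def)
  then show ?thesis
    unfolding orbit_closure_def by (metis closed_Int_compact closed_closure inf_top_right)
qed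

section \<open>Factor maps onto odometers\<close>

text \<open>If a long enough window of the sequence \<open>z\<close> determines its position modulo \<open>p n\<close>, then
  the position of a point of the orbit closure is read off any approximation by shifts of \<open>z\<close>.\<close>

locale odometer_windows =
  fixes z :: "int \<Rightarrow> bool" and p :: "nat \<Rightarrow> nat"
  assumes p_pos: "\<And>n. 0 < p n"
    and p_dvd: "\<And>m n. m \<le> n \<Longrightarrow> p m dvd p n"
    and window: "\<And>n. \<exists>W. \<forall>j k. agree W (shift_by j z) (shift_by k z) \<longrightarrow> int (p n) dvd j - k"
begin

abbreviation "X \<equiv> orbit_closure z"

abbreviation "is_factor \<pi> \<equiv>
  \<pi> \<in> extensional X \<and>
  factor_map X left_shift (odometer p) (odometer_add p (odometer_Delta p 1)) \<pi> \<and>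
  \<pi> z = odometer_Delta p 0"

section \<open>Values and uniqueness of a factor map\<close>

lemma odometer_add_Delta: "odometer_add p (odometer_Delta p j) (odometer_Delta p k) = odometer_Delta p (j + k)"
  by (simp add: odometer_add_def odometer_Delta_def mod_simps)

text \<open>Translation by \<open>1\<close> is injective on the odometer, which lets the induction
  along the orbit also run towards negative shifts.\<close>

lemma odometer_add_1_cancel:
  assumes "odometer_add p (odometer_Delta p 1) g = odometer_Delta p (k + 1)" "g \<in> odometer p"
  shows "g = odometer_Delta p k"
proof
  fix n
  have "(1 mod int (p n) + g n) mod int (p n) = (k + 1) mod int (p n)"
    using fun_cong[OF assms(1), of n] by (simp add: odometer_add_def odometer_Delta_def)
  then have "(1 + g n) mod int (p n) = (1 + k) mod int (p n)"
    by (simp add: mod_simps add.commute)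
  then have "g n mod int (p n) = k mod int (p n)"
    by (simp add: mod_eq_dvd_iff)
  then show "g n = odometer_Delta p k n"
    using assms(2) by (simp add: odometer_def odometer_Delta_def)
qed

lemma factor_map_at_shift:
  assumes "is_factor \<pi>"
  shows "\<pi> (shift_by k z) = odometer_Delta p k"
proof (induction k rule: int_induct[where k = 0])
  case base
  then show ?case using assms by simp
next
  case (step1 i)
  then show ?case
    using assms odometer_add_Delta[of 1 i] shift_by_in_orbit_closure[of i z]
    by (auto simp: factor_map_def add.commute dest!: bspec[of _ _ "shift_by i z"])
next
  case (step2 i)
  have "shift_by (i - 1) z \<in> X" by (rule shift_by_in_orbit_closure)
  moreover have "left_shift (shift_by (i - 1) z) = shift_by i z" by simp
  ultimately have "odometer_add p (odometer_Delta p 1) (\<pi> (shift_by (i - 1) z)) = odometer_Delta p (i - 1 + 1)"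
    "\<pi> (shift_by (i - 1) z) \<in> odometer p"
    using assms step2 unfolding factor_map_def by (metis diff_add_cancel, blast)
  then show ?case by (rule odometer_add_1_cancel)
qed

text \<open>A single coordinate takes values in a discrete space, so the points with the same value
  as \<open>x\<close> form a relatively open set. Its intersection with a window around
  \<open>x\<close> meets the orbit, which yields one \<open>k\<close> for both requirements.\<close>

lemma factor_map_approx:
  assumes "is_factor \<pi>" "x \<in> X"
  shows "\<exists>k. agree W x (shift_by k z) \<and> \<pi> x n = k mod int (p n)"
proof -
  have "continuous_on X (\<lambda>x. \<pi> x n)"
    using assms by (auto simp: factor_map_def intro: continuous_on_product_then_coordinatewise)
  then obtain U where U: "open U" "U \<inter> X = (\<lambda>x. \<pi> x n) -` {\<pi> x n} \<inter> X"
    using continuous_on_open_invariant[of X "\<lambda>x. \<pi> x n"] open_discrete[of "{\<pi> x n}"] by meson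
  have "open (U \<inter> {y. agree W x y})"
    by (intro open_Int U(1) open_agree)
  moreover have "x \<in> U \<inter> {y. agree W x y}"
    using U(2) assms(2) by (auto simp: agree_def)
  ultimately have "(U \<inter> {y. agree W x y}) \<inter> range (\<lambda>k. shift_by k z) \<noteq> {}"
    using assms(2) open_Int_closure_eq_empty unfolding orbit_closure_def by blast
  then obtain k where k: "shift_by k z \<in> U" "agree W x (shift_by k z)"
    by blast
  then have "shift_by k z \<in> (\<lambda>x. \<pi> x n) -` {\<pi> x n} \<inter> X"
    using U(2) shift_by_in_orbit_closure by blast
  then have "\<pi> x n = \<pi> (shift_by k z) n"
    by simp
  then show ?thesis
    using k(2) factor_map_at_shift[OF assms(1)] by (auto simp: odometer_Delta_def)
qed

text \<open>On the radius supplied by \<open>window\<close> all approximating shifts of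
  \<open>z\<close> have the same residue, and \<open>factor_map_approx\<close> gives one whose
  residue is the coordinate of \<pi>. The radius therefore depends on \<open>n\<close> only, neither
  on \<pi> nor on \<open>x\<close>.\<close>

lemma factor_map_window:
  "\<exists>W. \<forall>\<pi> x k. is_factor \<pi> \<longrightarrow> x \<in> X \<longrightarrow> agree W x (shift_by k z) \<longrightarrow> \<pi> x n = k mod int (p n)"
proof -
  obtain W where W: "\<And>j k. agree W (shift_by j z) (shift_by k z) \<Longrightarrow> int (p n) dvd j - k"
    using window by metis
  have "\<pi> x n = k mod int (p n)" if \<pi>: "is_factor \<pi>" "x \<in> X" and k: "agree W x (shift_by k z)" for \<pi> x k
  proof -
    obtain j where j: "agree W x (shift_by j z)" "\<pi> x n = j mod int (p n)"
      using factor_map_approx[OF \<pi>] by blast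
    have "agree W (shift_by j z) (shift_by k z)"
      using agree_trans[OF agree_sym[OF j(1)] k] .
    then show ?thesis using W j(2) by (metis mod_eq_dvd_iff)
  qed
  then show ?thesis by blast
qed

lemma factor_map_unique:
  assumes "is_factor \<pi>" "is_factor \<rho>"
  shows "\<pi> = \<rho>"
proof (rule extensionalityI[of _ X])
  fix x assume x: "x \<in> X"
  show "\<pi> x = \<rho> x"
  proof
    fix n
    obtain W where W: "\<And>\<pi> x k. is_factor \<pi> \<Longrightarrow> x \<in> X \<Longrightarrow> agree W x (shift_by k z) \<Longrightarrow> \<pi> x n = k mod int (p n)"
      using factor_map_window by meson
    obtain k where "agree W x (shift_by k z)"
      using x orbit_closure_iff by blast
    then show "\<pi> x n = \<rho> x n"
      using W[OF assms(1) x] W[OF assms(2) x] by simp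
  qed
qed (use assms in auto)

section \<open>Existence of the factor map\<close>

lemma factor_map_exists: "\<exists>\<pi>. is_factor \<pi>"
proof -
  obtain W where W: "\<And>n j k. agree (W n) (shift_by j z) (shift_by k z) \<Longrightarrow> int (p n) dvd j - k"
    using window by metis
  \<comment> \<open>The choice of \<open>k\<close> is immaterial: two admissible shifts agree with
    each other on \<open>W n\<close>, so they are congruent modulo \<open>p n\<close>.\<close>
  define \<pi> where "\<pi> = (\<lambda>x\<in>X. \<lambda>n. (SOME k. agree (W n) x (shift_by k z)) mod int (p n))"
  have eq: "\<pi> x n = k mod int (p n)" if "x \<in> X" "agree (W n) x (shift_by k z)" for x n k
  proof -
    have "agree (W n) x (shift_by (SOME k. agree (W n) x (shift_by k z)) z)"
      using that(2) by (rule someI)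
    then have "int (p n) dvd (SOME k. agree (W n) x (shift_by k z)) - k"
      using W agree_trans agree_sym that(2) by metis
    then show ?thesis using that(1) by (simp add: \<pi>_def mod_eq_dvd_iff)
  qed
  have cont: "continuous_on X \<pi>"
  proof (intro continuous_on_coordinatewise_then_product continuous_on_if_window)
    fix n x assume x: "x \<in> X"
    then obtain k where k: "agree (W n) x (shift_by k z)"
      using orbit_closure_iff by blast
    have "\<pi> y n = \<pi> x n" if "y \<in> X" "agree (W n) x y" for y
      using eq[OF x k] eq[OF that(1) agree_trans[OF agree_sym[OF that(2)] k]] by simp
    then show "\<exists>W. \<forall>y\<in>X. agree W x y \<longrightarrow> \<pi> y n = \<pi> x n" by blast
  qed
  have shift: "\<pi> (shift_by k z) = odometer_Delta p k" for k
    using eq[OF shift_by_in_orbit_closure, of _ k k] by (auto simp: odometer_Delta_def agree_def)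
  have equiv: "\<pi> (left_shift x) = odometer_add p (odometer_Delta p 1) (\<pi> x)" if x: "x \<in> X" for x
  proof
    fix n
    obtain k where k: "agree (W n + \<bar>1\<bar>) x (shift_by k z)"
      using x orbit_closure_iff by blast
    have "\<pi> (left_shift x) n = (1 + k) mod int (p n)"
      using eq[OF orbit_closure_shift_by[OF x]] agree_shift[OF k] by simp
    also have "\<dots> = odometer_add p (odometer_Delta p 1) (\<pi> x) n"
      using eq[OF x agree_mono[OF k]] by (simp add: odometer_add_def odometer_Delta_def mod_simps)
    finally show "\<pi> (left_shift x) n = \<dots>" .
  qed
  have "\<pi> x \<in> odometer p" if x: "x \<in> X" for x
  proof -
    have "\<pi> x n mod int (p m) = \<pi> x m" if "m \<le> n" for m n
    proof -
      obtain k where "agree (max (W m) (W n)) x (shift_by k z)"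
        using x orbit_closure_iff by blast
      then have "\<pi> x m = k mod int (p m)" "\<pi> x n = k mod int (p n)"
        using eq[OF x] agree_mono by (metis max.cobounded1, metis max.cobounded2)
      then show ?thesis using p_dvd[OF that] by (simp add: mod_mod_cancel)
    qed
    moreover have "\<pi> x n \<in> {0..<int (p n)}" for n
      using p_pos x by (simp add: \<pi>_def)
    ultimately show ?thesis by (auto simp: odometer_def)
  qed
  \<comment> \<open>Surjectivity: the image is compact, hence closed, and contains the dense set of
    all \<open>odometer_Delta p k\<close>. The coordinates \<open>g n\<close>, used as integers
    \<open>k\<close>, give a sequence converging to \<open>g\<close>, since \<open>g n\<close>
    reduces to \<open>g m\<close> for \<open>n\<close> at least \<open>m\<close>.\<close>
  moreover have "g \<in> \<pi> ` X" if g: "g \<in> odometer p" for g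
  proof -
    have "Hausdorff_space (euclidean :: int topology)"
      unfolding Hausdorff_space_def disjnt_def
      by (metis hausdorff open_openin)
    then have "Hausdorff_space (euclidean :: (nat \<Rightarrow> int) topology)"
      by (subst euclidean_product_topology[symmetric]) (simp add: Hausdorff_space_product_topology)
    then have "closed (\<pi> ` X)"
      using compactin_imp_closedin[of euclidean "\<pi> ` X"]
        compact_continuous_image[OF cont compact_orbit_closure] by simp
    moreover have "(\<lambda>n. odometer_Delta p (g n)) \<longlonglongrightarrow> g"
    proof (rule tendsto_fun, rule tendsto_eventually)
      fix m
      show "\<forall>\<^sub>F n in sequentially. odometer_Delta p (g n) m = g m"
        using eventually_ge_at_top[of m]
        by eventually_elim (use g in \<open>simp add: odometer_def odometer_Delta_def\<close>)
    qed
    moreover have "odometer_Delta p k \<in> \<pi> ` X" for k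
      using shift shift_by_in_orbit_closure by (metis imageI)
    ultimately show ?thesis
      by (intro Lim_in_closed_set[where F = sequentially]) (auto intro: always_eventually)
  qed
  ultimately have "\<pi> ` X = odometer p" by auto
  then have "is_factor \<pi>"
    using cont equiv shift[of 0] by (simp add: factor_map_def) (simp add: \<pi>_def)
  then show ?thesis by (rule exI[of _ \<pi>])
qed

lemma is_factor_THE: "is_factor (THE \<pi>. is_factor \<pi>)"
  by (rule theI'[of "\<lambda>\<pi>. is_factor \<pi>"]) (rule ex_ex1I[OF factor_map_exists factor_map_unique])

end

section \<open>Arithmetic of the set \<open>B1\<close>\<close>

locale B1_family =
  fixes N :: enat and c :: "nat \<Rightarrow> nat"
  assumes N_ge_1: "1 \<le> N"
    and c_odd: "1 \<le> k \<Longrightarrow> odd (c k)"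
    and c_gt_1: "1 \<le> k \<Longrightarrow> 1 < c k"
    and c_coprime: "1 \<le> j \<Longrightarrow> 1 \<le> k \<Longrightarrow> j \<noteq> k \<Longrightarrow> coprime (c j) (c k)"
begin

abbreviation "\<eta> \<equiv> eta1 N c"
abbreviation "p \<equiv> period1 N c"
abbreviation "S \<equiv> S1 N c"

lemma mem_B1_iff:
  "b \<in> B1 N c \<longleftrightarrow> (\<exists>k\<ge>1. b = 2 ^ k * c k \<or> enat k < N \<and> b = 2 ^ (k - 1) * (c k)\<^sup>2)"
  by (auto simp: B1_def)

text \<open>Replaces the bound by \<open>N - 1\<close> with the strict inequality used in
  \<open>B1\<close>, so that finite and infinite \<open>N\<close> are treated alike.\<close>

lemma mem_S1_iff:
  "b \<in> S n \<longleftrightarrow> (\<exists>k\<ge>1. k \<le> n \<and> (b = 2 ^ k * c k \<or> enat k < N \<and> b = 2 ^ (k - 1) * (c k)\<^sup>2))"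
proof -
  have "enat k \<le> min (enat n) (N - 1) \<longleftrightarrow> k \<le> n \<and> enat k < N" for k
  proof (cases N)
    case (enat M)
    then show ?thesis using N_ge_1 by (auto simp: one_enat_def)
  qed simp
  then show ?thesis by (auto simp: S1_def)
qed

lemma S1_subset_B1: "S n \<subseteq> B1 N c"
  by (auto simp: mem_B1_iff mem_S1_iff)

lemma eta_iff: "\<eta> s \<longleftrightarrow> (\<forall>b\<in>B1 N c. \<not> int b dvd s)"
  by (auto simp: free_char_def free_set_def dvd_def)

text \<open>Elements of \<open>B1 N c\<close> of index \<open>k > n\<close> are multiples of
  \<open>2 ^ n\<close>, because already \<open>k - 1 \<ge> n\<close>; they cannot divide
  \<open>s\<close>.\<close>

lemma eta_iff_S1:
  assumes "\<not> 2 ^ n dvd s"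
  shows "\<eta> s \<longleftrightarrow> (\<forall>b\<in>S n. \<not> int b dvd s)"
proof -
  have "b \<in> S n" if b: "b \<in> B1 N c" "int b dvd s" for b
  proof -
    obtain k where k: "k \<ge> 1" "b = 2 ^ k * c k \<or> enat k < N \<and> b = 2 ^ (k - 1) * (c k)\<^sup>2"
      using b(1) mem_B1_iff by auto
    have "\<not> 2 ^ n dvd int b"
      using assms b(2) dvd_trans by blast
    then have "\<not> 2 ^ n dvd b"
      by (metis of_nat_dvd_iff of_nat_numeral of_nat_power)
    then have "\<not> (2::nat) ^ n dvd 2 ^ k \<or> \<not> (2::nat) ^ n dvd 2 ^ (k - 1) \<and> enat k < N \<and> b = 2 ^ (k - 1) * (c k)\<^sup>2"
      using k(2) by auto
    then have "k \<le> n"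
      by (metis One_nat_def Suc_pred k(1) le_imp_power_dvd less_eq_Suc_le not_less_eq_eq nat_le_linear)
    then show ?thesis using k mem_S1_iff by auto
  qed
  then show ?thesis using S1_subset_B1 eta_iff by blast
qed

lemma S1_cases:
  assumes "b \<in> S n"
  obtains k where "1 \<le> k" "k \<le> n" "b = 2 ^ k * c k \<or> b = 2 ^ (k - 1) * (c k)\<^sup>2"
    "int b dvd 2 ^ n * (int (c k))\<^sup>2"
proof -
  obtain k where k: "1 \<le> k" "k \<le> n" "b = 2 ^ k * c k \<or> b = 2 ^ (k - 1) * (c k)\<^sup>2"
    using assms unfolding mem_S1_iff by blast
  then have "int b dvd 2 ^ n * (int (c k))\<^sup>2"
    by (auto intro!: mult_dvd_mono le_imp_power_dvd)
  then show ?thesis using k that by blast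
qed

section \<open>The periods and the Toeplitz property\<close>

lemma S1_pos: "b \<in> S n \<Longrightarrow> 0 < b"
  using c_gt_1 by (fastforce simp: mem_S1_iff)

lemma finite_S1: "finite (S n)"
proof -
  have "S n \<subseteq> (\<lambda>k. 2 ^ k * c k) ` {..n} \<union> (\<lambda>k. 2 ^ (k - 1) * (c k)\<^sup>2) ` {..n}"
    by (auto simp: mem_S1_iff)
  then show ?thesis by (rule finite_subset) simp
qed

lemma S1_dvd_period: "b \<in> S n \<Longrightarrow> b dvd p n"
  by (simp add: period1_def)

lemma period_pos: "0 < p n"
  using finite_S1 S1_pos by (metis Lcm_0_iff_nat neq0_conv period1_def)

lemma period_dvd: "m \<le> n \<Longrightarrow> p m dvd p n"
  unfolding period1_def by (rule Lcm_subset) (force simp: mem_S1_iff)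

lemma period_dvd_int_iff: "int (p n) dvd d \<longleftrightarrow> (\<forall>b\<in>S n. int b dvd d)"
proof -
  have "int b dvd d \<longleftrightarrow> b dvd nat \<bar>d\<bar>" for b
    by (metis abs_ge_zero dvd_abs_iff nat_0_le of_nat_dvd_iff)
  then show ?thesis unfolding period1_def by (simp only: Lcm_dvd_iff)
qed

lemma two_power_dvd_period: "2 ^ n dvd p n"
proof (cases "n = 0")
  case False
  then have "2 ^ n * c n \<in> S n" unfolding mem_S1_iff by (intro exI[of _ n]) auto
  then show ?thesis using S1_dvd_period dvd_mult_left by blast
qed simp

text \<open>The condition on \<open>2 ^ n\<close> carries non-divisibility from \<open>s\<close> to
  \<open>t\<close>, so both values are decided by \<open>S n\<close>.\<close>

lemma eta_eqI:
  assumes "\<not> 2 ^ n dvd s" "2 ^ n dvd t - s" "\<And>b. b \<in> S n \<Longrightarrow> int b dvd s \<longleftrightarrow> int b dvd t"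
  shows "\<eta> t = \<eta> s"
proof -
  have "\<not> 2 ^ n dvd t" using assms(1,2) by (meson dvd_diffD1 dvd_diff_commute dvd_diff_right_iff)
  then show ?thesis using assms(1,3) eta_iff_S1 by blast
qed

lemma eta_eqI_cong:
  assumes "\<not> 2 ^ n dvd s" "\<And>b. b \<in> S n \<Longrightarrow> int b dvd t - s" "2 ^ n dvd t - s"
  shows "\<eta> t = \<eta> s"
proof (rule eta_eqI[OF assms(1,3)])
  fix b assume "b \<in> S n"
  then show "int b dvd s \<longleftrightarrow> int b dvd t"
    using dvd_add_right_iff[OF assms(2), of b s] by simp
qed

lemma exists_two_power_not_dvd:
  fixes s :: int
  assumes "s \<noteq> 0"
  shows "\<not> 2 ^ nat \<bar>s\<bar> dvd s"
proof
  assume "2 ^ nat \<bar>s\<bar> dvd s"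
  then have "2 ^ nat \<bar>s\<bar> \<le> \<bar>s\<bar>" using dvd_imp_le_int[OF assms] by fastforce
  moreover have "int (nat \<bar>s\<bar>) < 2 ^ nat \<bar>s\<bar>"
    by (metis less_exp of_nat_less_iff of_nat_numeral of_nat_power)
  ultimately show False by simp
qed

lemma eta_toeplitz:
  assumes "\<eta> s"
  shows "\<exists>m. \<forall>t. int (p m) dvd t - s \<longrightarrow> \<eta> t"
proof -
  \<comment> \<open>Since \<open>B1 N c\<close> is nonempty, \<open>0\<close> is not free. A free
    \<open>s\<close> is thus nonzero, and \<open>2 ^ nat \<bar>s\<bar>\<close> exceeds it in
    absolute value.\<close>
  have "2 ^ 1 * c 1 \<in> B1 N c" using mem_B1_iff by blast
  then have "s \<noteq> 0" using assms eta_iff by auto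
  then have n: "\<not> 2 ^ nat \<bar>s\<bar> dvd s" (is "\<not> 2 ^ ?n dvd s") by (rule exists_two_power_not_dvd)
  have "\<eta> t" if "int (p ?n) dvd t - s" for t
  proof -
    have "2 ^ ?n dvd t - s"
      using two_power_dvd_period[of ?n] that by (metis dvd_trans of_nat_dvd_iff of_nat_numeral of_nat_power)
    then show ?thesis using eta_eqI_cong[OF n] that period_dvd_int_iff assms by blast
  qed
  then show ?thesis by blast
qed

section \<open>Free numbers in progressions and separation of residues\<close>

lemma c_coprime_int: "1 \<le> j \<Longrightarrow> 1 \<le> k \<Longrightarrow> j \<noteq> k \<Longrightarrow> coprime (int (c j)) (int (c k))"
  using c_coprime by (simp add: coprime_int_iff)

lemma c_coprime_2_int: "1 \<le> k \<Longrightarrow> coprime (int (c k)) 2"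
  using c_odd by simp

text \<open>Among \<open>d\<close> and \<open>d + b\<close> at least one is not divisible by the next power of \<open>2\<close> and passes the
  tests of \<open>B1\<close> with index \<open>j\<close>; the tests with another index are passed after moving it, by the
  Chinese remainder theorem, to a representative that is \<open>1\<close> modulo the other \<open>c k\<close>.\<close>

lemma free_in_progression:
  assumes b: "b \<in> B1 N c" and d: "\<not> int b dvd d"
  shows "\<exists>u. int b dvd u - d \<and> \<eta> u"
proof -
  obtain j where j: "j \<ge> 1" and bj: "b = 2 ^ j * c j \<or> enat j < N \<and> b = 2 ^ (j - 1) * (c j)\<^sup>2"
    using b mem_B1_iff by auto
  define C where "C = int (c j)"
  have C: "coprime C 2" "1 < C" using c_coprime_2_int c_gt_1 j by (auto simp: C_def)
  \<comment> \<open>The modulus \<open>2 ^ n * C\<^sup>2\<close> is a multiple of \<open>b\<close>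
    and of the divisors of index \<open>j\<close>, so any number congruent to \<open>d'\<close>
    stays in the progression and passes the same tests. Here \<open>n\<close> is
    \<open>Suc j\<close> for the first kind of \<open>b\<close> and \<open>j\<close> for the
    second.\<close>
  have "\<exists>n d'. j \<le> n \<and> int b dvd 2 ^ n * C\<^sup>2 \<and> int b dvd d' - d \<and> \<not> 2 ^ n dvd d' \<and> \<not> 2 ^ j * C dvd d' \<and> 
      (enat j < N \<longrightarrow> \<not> 2 ^ (j - 1) * C\<^sup>2 dvd d')"
    using bj
  proof
    assume b: "b = 2 ^ j * c j"
    then have ib: "int b = 2 ^ j * C" by (simp add: C_def)
    have 1: "\<not> (2 ^ j dvd d \<and> C dvd d)"
      using d ib C by (metis coprime_commute coprime_power_left_iff divides_mult)
    have 2: "\<not> (2 ^ Suc j dvd d \<and> 2 ^ Suc j dvd d + int b)"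
    proof
      assume "2 ^ Suc j dvd d \<and> 2 ^ Suc j dvd d + int b"
      then have "2 ^ j * 2 dvd 2 ^ j * C" using ib dvd_add_right_iff power_Suc2 by metis
      then show False using C(1) by simp
    qed
    have 3: "\<not> (C\<^sup>2 dvd d \<and> C\<^sup>2 dvd d + int b)"
    proof
      assume "C\<^sup>2 dvd d \<and> C\<^sup>2 dvd d + int b"
      then have "C * C dvd 2 ^ j * C" using ib dvd_add_right_iff power2_eq_square by metis
      then have "C dvd 2 ^ j" using C(2) by simp
      moreover have "coprime C (2 ^ j)" using C(1) by simp
      ultimately show False using C(2) by (metis coprime_absorb_left not_less_iff_gr_or_eq zdvd1_eq abs_of_pos less_trans zero_less_one)
    qed
    have 4: "2 ^ j dvd d" if "2 ^ Suc j dvd d \<or> 2 ^ Suc j dvd d + int b"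
    proof -
      have "2 ^ j dvd d \<or> 2 ^ j dvd d + int b" using that dvd_mult_right power_Suc by metis
      then show ?thesis using ib by (simp add: dvd_add_left_iff)
    qed
    have 5: "C dvd d" if "C\<^sup>2 dvd d \<or> C\<^sup>2 dvd d + int b"
    proof -
      have "C dvd d \<or> C dvd d + int b" using that dvd_mult_right power2_eq_square by metis
      then show ?thesis using ib by (simp add: dvd_add_left_iff)
    qed
    \<comment> \<open>Each of \<open>2 ^ Suc j\<close> and \<open>C\<^sup>2\<close> rules out at
      most one candidate. If they ruled out different ones, both \<open>2 ^ j\<close> and
      \<open>C\<close> would divide \<open>d\<close>, and hence so would \<open>b\<close>.\<close>
    have "\<exists>d'\<in>{d, d + int b}. \<not> 2 ^ Suc j dvd d' \<and> \<not> C\<^sup>2 dvd d'"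
      using 1 2 3 4 5 by blast
    then obtain d' where d': "d' \<in> {d, d + int b}" "\<not> 2 ^ Suc j dvd d'" "\<not> C\<^sup>2 dvd d'" by blast
    have "int b dvd d' - d" "\<not> int b dvd d'" using d d'(1) by auto
    moreover have "int b dvd 2 ^ Suc j * C\<^sup>2" using ib by (simp add: mult_dvd_mono)
    moreover have "\<not> 2 ^ (j - 1) * C\<^sup>2 dvd d'" using d'(3) dvd_mult_right by blast
    ultimately show ?thesis using d'(2) ib le_SucI by (intro exI[of _ "Suc j"] exI[of _ d']) auto
  next
    assume b: "enat j < N \<and> b = 2 ^ (j - 1) * (c j)\<^sup>2"
    then have ib: "int b = 2 ^ (j - 1) * C\<^sup>2" by (simp add: C_def)
    have "\<not> (2 ^ j dvd d \<and> 2 ^ j dvd d + int b)"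
    proof
      assume "2 ^ j dvd d \<and> 2 ^ j dvd d + int b"
      then have "2 ^ j dvd int b" using dvd_add_right_iff by blast
      then have "2 ^ (j - 1) * 2 dvd 2 ^ (j - 1) * C\<^sup>2"
        using ib j by (metis One_nat_def Suc_pred less_eq_Suc_le power_Suc2)
      then show False using C(1) by simp
    qed
    then obtain d' where d': "d' \<in> {d, d + int b}" "\<not> 2 ^ j dvd d'" by blast
    have "int b dvd d' - d" "\<not> int b dvd d'" using d d'(1) by auto
    moreover have "int b dvd 2 ^ j * C\<^sup>2" using ib by (simp add: mult_dvd_mono le_imp_power_dvd)
    moreover have "\<not> 2 ^ j * C dvd d'" using d'(2) dvd_mult_left by blast
    ultimately show ?thesis using d'(2) ib by (intro exI[of _ j] exI[of _ d']) auto
  qed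
  then obtain n d' where n: "j \<le> n" and bn: "int b dvd 2 ^ n * C\<^sup>2" and d': "int b dvd d' - d" "\<not> 2 ^ n dvd d'"
    "\<not> 2 ^ j * C dvd d'" "enat j < N \<longrightarrow> \<not> 2 ^ (j - 1) * C\<^sup>2 dvd d'"
    by blast
  define P where "P = (\<Prod>k\<in>{1..n} - {j}. int (c k))"
  have "coprime (2 ^ n * C\<^sup>2) P"
    unfolding P_def C_def
  proof (rule prod_coprime_right)
    fix k assume "k \<in> {1..n} - {j}"
    then show "coprime (2 ^ n * (int (c j))\<^sup>2) (int (c k))"
      using c_coprime_int[of j k] c_odd[of k] j by simp
  qed
  then obtain u where u: "[u = d'] (mod (2 ^ n * C\<^sup>2))" "[u = 1] (mod P)"
    using binary_chinese_remainder_int by blast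
  have u_dvd: "m dvd u \<longleftrightarrow> m dvd d'" if "m dvd 2 ^ n * C\<^sup>2" for m
    using u(1) that by (meson cong_dvd_iff cong_dvd_modulus)
  have "\<not> int b' dvd u" if "b' \<in> S n" for b'
  proof
    assume b'u: "int b' dvd u"
    obtain k where k: "k \<ge> 1" "k \<le> n" "b' = 2 ^ k * c k \<or> enat k < N \<and> b' = 2 ^ (k - 1) * (c k)\<^sup>2"
      using \<open>b' \<in> S n\<close> mem_S1_iff by auto
    show False
    proof (cases "k = j")
      case True
      have "2 ^ j * C dvd 2 ^ n * C\<^sup>2" "2 ^ (j - 1) * C\<^sup>2 dvd 2 ^ n * C\<^sup>2"
        using n by (auto intro!: mult_dvd_mono le_imp_power_dvd)
      then have "\<not> 2 ^ j * C dvd u" "enat j < N \<longrightarrow> \<not> 2 ^ (j - 1) * C\<^sup>2 dvd u"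
        using u_dvd d' by auto
      then show False using k(3) b'u True by (auto simp: C_def)
    next
      case False
      have "int (c k) dvd int b'" using k(3) by (auto simp: power2_eq_square)
      then have "int (c k) dvd u" using b'u dvd_trans by blast
      moreover have "int (c k) dvd P" unfolding P_def using k False by (intro dvd_prodI) auto
      ultimately have "int (c k) dvd 1" using u(2) by (meson cong_dvd_iff cong_dvd_modulus)
      then show False using c_gt_1[OF k(1)] by simp
    qed
  qed
  moreover have "\<not> 2 ^ n dvd u" using u_dvd d'(2) by simp
  ultimately have "\<eta> u" using eta_iff_S1 by blast
  moreover have "int b dvd u - d'" using u(1) bn by (meson cong_iff_dvd_diff dvd_trans)
  then have "int b dvd u - d" using d'(1) by (metis diff_add_cancel add_diff_eq dvd_add)
  ultimately show ?thesis by blast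
qed

text \<open>Choose \<open>b\<close> in \<open>S n\<close> not dividing \<open>r\<close>, and a free
  \<open>u\<close> congruent to \<open>r\<close>, hence to \<open>d\<close>, modulo
  \<open>b\<close>; by the Toeplitz property \<open>u\<close> stays free modulo some
  \<open>p m\<close>. Solving \<open>s + a + d = u\<close> modulo \<open>b * p m\<close> makes
  \<open>s + a + d\<close> free and \<open>s + a\<close> a multiple of \<open>b\<close>. The bound
  depends on \<open>r\<close> only, not on \<open>d\<close> or \<open>a\<close>.\<close>

lemma period_separated:
  assumes "\<not> int (p n) dvd r"
  shows "\<exists>P. \<forall>d. int (p n) dvd d - r \<longrightarrow> (\<forall>a. \<exists>s. 0 \<le> s \<and> s < P \<and> \<not> \<eta> (s + a) \<and> \<eta> (s + a + d))"
proof -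
  obtain b where b: "b \<in> S n" "\<not> int b dvd r"
    using assms period_dvd_int_iff by blast
  have bB: "b \<in> B1 N c" using b S1_subset_B1 by blast
  obtain u where u: "int b dvd u - r" "\<eta> u"
    using free_in_progression[OF bB b(2)] by blast
  obtain m where m: "\<And>t. int (p m) dvd t - u \<Longrightarrow> \<eta> t"
    using eta_toeplitz[OF u(2)] by blast
  define P where "P = int b * int (p m)"
  have "0 < P" using period_pos S1_pos[OF b(1)] by (simp add: P_def)
  have "\<exists>s. 0 \<le> s \<and> s < P \<and> \<not> \<eta> (s + a) \<and> \<eta> (s + a + d)" if d: "int (p n) dvd d - r" for d a
  proof -
    have "int b dvd d - r" using d b(1) period_dvd_int_iff by blast
    then have bud: "int b dvd u - d" using dvd_diff[OF u(1)] by fastforce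
    define s where "s = (u - d - a) mod P"
    have "P dvd - ((u - d - a) - s)" unfolding s_def dvd_minus_iff by (rule dvd_minus_mod)
    then have "P dvd s + a + d - u" by (simp add: algebra_simps)
    then have "int b dvd s + a + d - u" "int (p m) dvd s + a + d - u"
      unfolding P_def by (auto dest: dvd_mult_left dvd_mult_right)
    then have "int b dvd (s + a + d - u) + (u - d)" "\<eta> (s + a + d)"
      using bud by (blast intro: dvd_add, blast intro: m)
    then have "int b dvd s + a" by simp
    then have "\<not> \<eta> (s + a)" using bB eta_iff by blast
    moreover have "0 \<le> s" "s < P" using \<open>0 < P\<close> by (simp_all add: s_def)
    ultimately show ?thesis using \<open>\<eta> (s + a + d)\<close> by blast
  qed
  then show ?thesis by blast
qed

sublocale odometer_windows \<eta> p
proof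
  fix n
  obtain P where P: "\<And>r d a. \<not> int (p n) dvd r \<Longrightarrow> int (p n) dvd d - r \<Longrightarrow>
      \<exists>s. 0 \<le> s \<and> s < P r \<and> \<not> \<eta> (s + a) \<and> \<eta> (s + a + d)"
    using period_separated[of n] by metis
  \<comment> \<open>Only the residue of \<open>j - k\<close> matters, so finitely many bounds
    suffice. The value of \<open>P\<close> at \<open>0\<close> is arbitrary but can only enlarge the
    maximum.\<close>
  define W where "W = Max (P ` {0..<int (p n)})"
  have "int (p n) dvd j - k" if agree: "agree W (shift_by j \<eta>) (shift_by k \<eta>)" for j k
  proof (rule ccontr)
    assume nd: "\<not> int (p n) dvd j - k"
    define r where "r = (j - k) mod int (p n)"
    have r: "\<not> int (p n) dvd r" "int (p n) dvd (j - k) - r" "r \<in> {0..<int (p n)}"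
      using nd period_pos[of n] by (auto simp: r_def dvd_mod_iff)
    then obtain s where s: "0 \<le> s" "s < P r" "\<not> \<eta> (s + k)" "\<eta> (s + k + (j - k))"
      using P by blast
    have "P r \<le> W" unfolding W_def using r(3) by (intro Max_ge) auto
    then have "shift_by j \<eta> s = shift_by k \<eta> s" using agreeD[OF agree] s by simp
    then show False using s by (simp add: shift_by_def)
  qed
  then show "\<exists>W. \<forall>j k. agree W (shift_by j \<eta>) (shift_by k \<eta>) \<longrightarrow> int (p n) dvd j - k" by blast
qed (use period_pos period_dvd in auto)

lemma X1_eq: "X1 N c = X"
  by (simp add: free_subshift_def)

lemma pi1_is_factor: "is_factor (pi1 N c)"
  unfolding pi1_def X1_eq by (rule is_factor_THE)

end

section \<open>The maps \<open>F1\<close>\<close>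

locale B1_index = B1_family +
  fixes l :: nat
  assumes l_ge_1: "1 \<le> l" and l_less_N: "enat l < N"
begin

abbreviation "C \<equiv> int (c l)"
abbreviation "q \<equiv> int (p l div c l)"
abbreviation "F \<equiv> F1 N c l"
abbreviation "position \<equiv> \<lambda>x. pi1 N c x l"

text \<open>This is \<open>F \<eta>\<close> written without the factor map, as the position of
  \<eta> is \<open>0\<close>.\<close>

definition swapped :: "int \<Rightarrow> bool"
  where "swapped s = (if C dvd s then \<eta> (s + q) else \<eta> s)"

section \<open>Divisibility properties of \<open>q\<close>\<close>

lemma C_gt_1: "1 < C"
  using c_gt_1 l_ge_1 by simp

lemma C_coprime_2: "coprime C (2 ^ n)"
  using c_odd l_ge_1 by simp

lemma mem_S1_l: "2 ^ l * c l \<in> S l" "2 ^ (l - 1) * (c l)\<^sup>2 \<in> S l"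
  using l_ge_1 l_less_N by (auto simp: mem_S1_iff)

lemma dvd_period: "int (2 ^ l * c l) dvd int (p l)" "C\<^sup>2 dvd int (p l)"
  using S1_dvd_period[OF mem_S1_l(1)] S1_dvd_period[OF mem_S1_l(2)]
  by (metis of_nat_dvd_iff, metis dvd_mult_right of_nat_dvd_iff of_nat_power)

lemma C_q: "C * q = int (p l)"
proof -
  have "c l dvd p l" using dvd_period(1) by (metis dvd_mult_right of_nat_dvd_iff)
  then show ?thesis by (metis dvd_mult_div_cancel of_nat_mult)
qed

lemma dvd_qI:
  assumes "C * b dvd int (p l)"
  shows "b dvd q"
  using assms C_gt_1 unfolding C_q[symmetric] by simp

lemma two_power_C_dvd_q: "2 ^ l * C dvd q"
proof (rule dvd_qI)
  have "2 ^ l dvd int (p l)" using dvd_period(1) by (metis dvd_mult_left of_nat_mult of_nat_numeral of_nat_power)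
  then have "C\<^sup>2 * 2 ^ l dvd int (p l)" using dvd_period(2) C_coprime_2 by (intro divides_mult) auto
  then show "C * (2 ^ l * C) dvd int (p l)" by (simp add: power2_eq_square mult_ac)
qed

text \<open>Passing from \<open>p l\<close> to \<open>q\<close> removes one factor \<open>C\<close>.
  For an index other than \<open>l\<close> this is harmless, since \<open>b\<close> is coprime to
  \<open>C\<close>; for \<open>2 ^ l * c l\<close> one factor \<open>C\<close> remains.\<close>

lemma S1_l_dvd_q:
  assumes b: "b \<in> S l" "b \<noteq> 2 ^ (l - 1) * (c l)\<^sup>2"
  shows "int b dvd q"
proof -
  obtain k where k: "1 \<le> k" "k \<le> l" "b = 2 ^ k * c k \<or> b = 2 ^ (k - 1) * (c k)\<^sup>2"
    using b(1) by (rule S1_cases)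
  show ?thesis
  proof (cases "k = l")
    case True
    then show ?thesis using k b(2) two_power_C_dvd_q by simp
  next
    case False
    have "coprime C (int b)"
      using k(3) c_coprime_int[OF l_ge_1 k(1)] False c_odd[OF l_ge_1] by auto
    moreover have "C dvd int (p l)" using dvd_period(1) by (metis dvd_mult_right of_nat_mult)
    moreover have "int b dvd int (p l)" using S1_dvd_period[OF b(1)] by simp
    ultimately show ?thesis by (intro dvd_qI divides_mult)
  qed
qed

lemma C_dvd_q: "C dvd q"
  using two_power_C_dvd_q dvd_mult_right by blast

lemma eta_zero:
  assumes "2 ^ l * C dvd s"
  shows "\<not> \<eta> s"
  using assms mem_S1_l(1) S1_subset_B1 eta_iff by fastforce

lemma dvd_two_powerI:
  assumes "C dvd s" "2 ^ n dvd s"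
  shows "2 ^ n * C dvd s"
  using assms C_coprime_2 by (metis coprime_commute divides_mult)

text \<open>If \<open>2 ^ l\<close> divides \<open>s\<close>, then \<open>2 ^ l * C\<close> divides
  both arguments and neither is free; otherwise \<open>S l\<close> decides both values.\<close>

lemma eta_period_shift:
  assumes "C dvd s"
  shows "\<eta> (s + int (p l)) = \<eta> s"
proof (cases "2 ^ l dvd s")
  case True
  then have "2 ^ l * C dvd s" using assms by (intro dvd_two_powerI)
  moreover from this have "2 ^ l * C dvd s + int (p l)" using dvd_period(1) by (intro dvd_add) simp_all
  ultimately show ?thesis using eta_zero by blast
next
  case False
  have "2 ^ l dvd int (p l)" using two_power_dvd_period[of l] by (metis of_nat_dvd_iff of_nat_numeral of_nat_power)
  then show ?thesis by (intro eta_eqI_cong[OF False]) (simp_all add: S1_dvd_period)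
qed

text \<open>Every element of \<open>S l\<close> divides \<open>C\<^sup>2 * M\<close> with
  \<open>M\<close> coprime to \<open>C\<close>, so \<open>q\<close> divides \<open>C * M\<close>.
  Hence \<open>q\<close> cannot supply the second factor \<open>C\<close>, which must come from
  \<open>i\<close>.\<close>

lemma C_square_dvd_q:
  assumes "C\<^sup>2 dvd int i * q"
  shows "C dvd int i"
proof -
  define M where "M = 2 ^ l * (\<Prod>k\<in>{1..l} - {l}. (int (c k))\<^sup>2)"
  have "int b dvd C\<^sup>2 * M" if "b \<in> S l" for b
  proof -
    obtain k where k: "1 \<le> k" "k \<le> l" "int b dvd 2 ^ l * (int (c k))\<^sup>2"
      using \<open>b \<in> S l\<close> by (rule S1_cases)
    note k(3)
    also have "2 ^ l * (int (c k))\<^sup>2 dvd 2 ^ l * (\<Prod>k\<in>{1..l}. (int (c k))\<^sup>2)"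
      using k by (intro mult_dvd_mono dvd_prodI) auto
    also have "(\<Prod>k\<in>{1..l}. (int (c k))\<^sup>2) = C\<^sup>2 * (\<Prod>k\<in>{1..l} - {l}. (int (c k))\<^sup>2)"
      using l_ge_1 by (intro prod.remove) auto
    finally show ?thesis by (simp add: M_def mult_ac)
  qed
  then have "C * q dvd C * (C * M)"
    unfolding C_q period_dvd_int_iff mult.assoc[symmetric] power2_eq_square[symmetric] by blast
  then have "q dvd C * M" using C_gt_1 by simp
  then have "int i * q dvd int i * (C * M)" by (rule mult_dvd_mono[OF dvd_refl])
  then have "C\<^sup>2 dvd int i * (C * M)" using assms dvd_trans by blast
  then have "C * C dvd C * (int i * M)" by (simp add: power2_eq_square mult.left_commute)
  then have "C dvd int i * M" using C_gt_1 by simp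
  moreover have "coprime C M"
    unfolding M_def coprime_mult_right_iff
  proof (intro conjI prod_coprime_right)
    fix k assume "k \<in> {1..l} - {l}"
    then show "coprime C ((int (c k))\<^sup>2)"
      using c_coprime_int[of l k] l_ge_1 by auto
  qed (use C_coprime_2 in simp)
  ultimately show ?thesis by (simp add: coprime_dvd_mult_left_iff)
qed

text \<open>The shift \<open>k\<close> is \<open>q\<close> modulo the square of \<open>C\<close> and negligible modulo all other elements of \<open>B1\<close>
  up to a large index. At a multiple \<open>s\<close> of \<open>C\<close>, both values vanish if \<open>2 ^ l\<close> divides \<open>s\<close>; otherwise
  only \<open>S l\<close> matters, and there \<open>q\<close> itself is negligible except modulo the square of \<open>C\<close>.\<close>

lemma swapped_approx: "\<exists>k. C dvd k \<and> agree W swapped (shift_by k \<eta>)"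
proof -
  \<comment> \<open>The bound \<open>n \<ge> \<bar>s\<bar>\<close> keeps \<open>2 ^ n\<close> from
    dividing a nonzero \<open>s\<close> in the window, and \<open>n \<ge> l\<close> makes
    \<open>k\<close> a multiple of \<open>2 ^ l\<close>.\<close>
  define n where "n = max l (nat W)"
  define M where "M = 2 ^ n * (\<Prod>k\<in>{1..n} - {l}. (int (c k))\<^sup>2)"
  have "coprime (C\<^sup>2) M"
    unfolding M_def coprime_mult_right_iff
  proof (intro conjI prod_coprime_right)
    fix k assume "k \<in> {1..n} - {l}"
    then show "coprime (C\<^sup>2) ((int (c k))\<^sup>2)"
      using c_coprime_int[of l k] l_ge_1 by auto
  qed (use C_coprime_2 in simp)
  then obtain k where "[k = q] (mod (C\<^sup>2))" "[k = 0] (mod M)"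
    using binary_chinese_remainder_int by blast
  then have kq: "C\<^sup>2 dvd k - q" and kM: "M dvd k"
    by (simp_all add: cong_iff_dvd_diff)
  have dvd_M: "2 ^ n * (int (c j))\<^sup>2 dvd M" if "1 \<le> j" "j \<le> n" "j \<noteq> l" for j
    unfolding M_def using that by (intro mult_dvd_mono dvd_prodI) auto
  have "C dvd k - q" using kq by (metis dvd_mult_left power2_eq_square)
  then have Ck: "C dvd k" using C_dvd_q by (metis diff_add_cancel dvd_add)
  have nk: "2 ^ n dvd k" using kM unfolding M_def by (rule dvd_mult_left)
  have lk: "2 ^ l dvd k" using nk by (rule dvd_trans[rotated]) (simp add: n_def le_imp_power_dvd)
  have lq: "2 ^ l dvd q" using two_power_C_dvd_q by (rule dvd_mult_left)
  have "swapped s = \<eta> (s + k)" if s: "\<bar>s\<bar> \<le> W" for s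
  proof (cases "C dvd s")
    \<comment> \<open>Off the multiples of \<open>C\<close>, no element of index \<open>l\<close>
      divides \<open>s\<close> or \<open>s + k\<close>, while all other elements of
      \<open>S n\<close> divide \<open>k\<close>.\<close>
    case False
    then have s0: "s \<noteq> 0" by auto
    have "\<not> 2 ^ n dvd s"
    proof -
      have "nat \<bar>s\<bar> \<le> n" using nat_mono[OF s] unfolding n_def by linarith
      then have "2 ^ nat \<bar>s\<bar> dvd (2 :: int) ^ n" by (rule le_imp_power_dvd)
      then show ?thesis using exists_two_power_not_dvd[OF s0] by (metis dvd_trans)
    qed
    moreover have "2 ^ n dvd s + k - s" using nk by simp
    moreover have "int b dvd s \<longleftrightarrow> int b dvd s + k" if "b \<in> S n" for b
    proof -
      obtain j where j: "1 \<le> j" "j \<le> n" "b = 2 ^ j * c j \<or> b = 2 ^ (j - 1) * (c j)\<^sup>2"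
          "int b dvd 2 ^ n * (int (c j))\<^sup>2"
        using \<open>b \<in> S n\<close> by (rule S1_cases)
      show ?thesis
      proof (cases "j = l")
        case True
        then have "C dvd int b" using j(3) by (auto simp: power2_eq_square)
        moreover have "\<not> C dvd s + k" using False Ck by (simp add: dvd_add_left_iff)
        ultimately show ?thesis using False by (metis dvd_trans)
      next
        case False
        have "int b dvd k" by (rule dvd_trans[OF j(4) dvd_trans[OF dvd_M[OF j(1,2) False] kM]])
        then show ?thesis by (simp add: dvd_add_left_iff)
      qed
    qed
    ultimately have "\<eta> (s + k) = \<eta> s" by (rule eta_eqI)
    then show ?thesis using False by (simp add: swapped_def)
  next
    case C: True
    show ?thesis
    proof (cases "2 ^ l dvd s")
      case True
      have "\<not> \<eta> (s + q)" "\<not> \<eta> (s + k)"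
        by (intro eta_zero dvd_two_powerI dvd_add C True Ck C_dvd_q lk lq)+
      then show ?thesis using C by (simp add: swapped_def)
    next
      case False
      have "\<eta> (s + k) = \<eta> (s + q)"
      proof (rule eta_eqI_cong[of l])
        show "\<not> 2 ^ l dvd s + q" using False lq by (simp add: dvd_add_left_iff)
        show "2 ^ l dvd s + k - (s + q)" using lk lq by (simp add: dvd_diff)
        fix b assume b: "b \<in> S l"
        show "int b dvd s + k - (s + q)"
        proof (cases "b = 2 ^ (l - 1) * (c l)\<^sup>2")
          case True
          have "2 ^ (l - 1) dvd (2 :: int) ^ l" by (rule le_imp_power_dvd) simp
          then have "2 ^ (l - 1) dvd k - q" using lk lq by (intro dvd_diff) (rule dvd_trans, assumption+)+
          then have "2 ^ (l - 1) * C\<^sup>2 dvd k - q" using kq C_coprime_2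
            by (intro divides_mult) (simp_all add: c_odd[OF l_ge_1])
          then show ?thesis using True by simp
        next
          case False
          obtain j where j: "1 \<le> j" "j \<le> l" "b = 2 ^ j * c j \<or> b = 2 ^ (j - 1) * (c j)\<^sup>2"
              "int b dvd 2 ^ l * (int (c j))\<^sup>2"
            using b by (rule S1_cases)
          have "int b dvd k"
          proof (cases "j = l")
            case True
            then show ?thesis using j(3) False dvd_two_powerI[OF Ck lk] by simp
          next
            case False
            have "j \<le> n" using j(2) by (simp add: n_def)
            moreover have "int b dvd 2 ^ n * (int (c j))\<^sup>2"
              using j(4) by (rule dvd_trans) (simp add: mult_dvd_mono le_imp_power_dvd n_def)
            ultimately show ?thesis using dvd_trans[OF dvd_M[OF j(1) _ False] kM] by (metis dvd_trans)
          qed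
          then show ?thesis using S1_l_dvd_q[OF b False] by simp
        qed
      qed
      then show ?thesis using C by (simp add: swapped_def)
    qed
  qed
  then have "agree W swapped (shift_by k \<eta>)" unfolding agree_def shift_by_def by blast
  then show ?thesis using Ck by blast
qed

section \<open>The action of \<open>F\<close> on approximations and its iterates\<close>

lemma F_apply:
  assumes "x \<in> X"
  shows "F x s = (if C dvd s + position x then x (s + q) else x s)"
proof -
  have "s \<in> {C * m - position x |m. True} \<longleftrightarrow> C dvd s + position x"
    by (auto simp: dvd_def algebra_simps)
  then show ?thesis using assms by (simp add: F1_def X1_eq)
qed

lemma position_window:
  obtains V where "0 \<le> V" "\<And>x k. x \<in> X \<Longrightarrow> agree V x (shift_by k \<eta>) \<Longrightarrow> position x = k mod int (p l)"
proof -
  obtain W where W: "\<And>x k. x \<in> X \<Longrightarrow> agree W x (shift_by k \<eta>) \<Longrightarrow> position x = k mod int (p l)"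
    using factor_map_window pi1_is_factor by meson
  show ?thesis
    by (rule that[of "max 0 W"]) (simp, meson W agree_mono max.cobounded2)
qed

lemma C_dvd_period: "C dvd int (p l)"
  using C_q by (metis dvd_triv_left)

lemma C_dvd_add_mod: "C dvd s + k mod int (p l) \<longleftrightarrow> C dvd s + k"
  using C_dvd_period by (metis dvd_mod_iff mod_add_right_eq)

text \<open>The additional radius \<open>q\<close> covers the entry at \<open>s + q\<close> that
  \<open>F\<close> may read.\<close>

lemma F_agree:
  assumes "x \<in> X" "position x = k mod int (p l)" "agree (W + q) x (shift_by k \<eta>)"
  shows "agree W (F x) (shift_by k swapped)"
  unfolding agree_def
proof (intro allI impI)
  fix s assume s: "\<bar>s\<bar> \<le> W"
  have "x s = \<eta> (s + k)" "x (s + q) = \<eta> (s + q + k)"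
    using s agreeD[OF assms(3), of s] agreeD[OF assms(3), of "s + q"] by (auto simp: shift_by_def)
  then show "F x s = shift_by k swapped s"
    using assms(1,2) by (simp add: F_apply C_dvd_add_mod swapped_def shift_by_def add_ac)
qed

lemma F_approx:
  assumes "x \<in> X"
  shows "\<exists>k j. agree W x (shift_by k \<eta>) \<and> position x = k mod int (p l) \<and> C dvd j \<and> agree W (F x) (shift_by (k + j) \<eta>)"
proof -
  obtain V where V: "0 \<le> V" "\<And>x k. x \<in> X \<Longrightarrow> agree V x (shift_by k \<eta>) \<Longrightarrow> position x = k mod int (p l)"
    using position_window by blast
  obtain k where k: "agree (max V W + q) x (shift_by k \<eta>)"
    using assms orbit_closure_iff by blast
  \<comment> \<open>The radius is chosen after \<open>k\<close>, as the approximation of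
    \<open>swapped\<close> still has to be shifted by \<open>k\<close>.\<close>
  obtain j where j: "C dvd j" "agree (W + \<bar>k\<bar>) swapped (shift_by j \<eta>)"
    using swapped_approx by blast
  have pos: "position x = k mod int (p l)"
    using V(2)[OF assms] agree_mono[OF k] by simp
  have "agree W (F x) (shift_by k swapped)"
    using F_agree[OF assms pos] agree_mono[OF k] by simp
  then have "agree W (F x) (shift_by (k + j) \<eta>)"
    using agree_shift[OF j(2)] agree_trans by fastforce
  moreover have "agree W x (shift_by k \<eta>)" using agree_mono[OF k] by simp
  ultimately show ?thesis using pos j(1) by blast
qed

lemma F_in_X:
  assumes "x \<in> X"
  shows "F x \<in> X"
  unfolding orbit_closure_iff
proof
  fix W
  show "\<exists>k. agree W (F x) (shift_by k \<eta>)" using F_approx[OF assms, of W] by blast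
qed

text \<open>The positions of \<open>x\<close> and \<open>F x\<close> differ by \<open>j\<close>
  modulo \<open>p l\<close>, and \<open>C\<close> divides both \<open>j\<close> and
  \<open>p l\<close>. All iterates thus act on the same coordinates.\<close>

lemma C_dvd_position_F:
  assumes "x \<in> X"
  shows "C dvd s + position (F x) \<longleftrightarrow> C dvd s + position x"
proof -
  obtain V where V: "0 \<le> V" "\<And>x k. x \<in> X \<Longrightarrow> agree V x (shift_by k \<eta>) \<Longrightarrow> position x = k mod int (p l)"
    using position_window by blast
  obtain k j where kj: "position x = k mod int (p l)" "C dvd j" "agree V (F x) (shift_by (k + j) \<eta>)"
    using F_approx[OF assms, of V] by blast
  have pos: "position (F x) = (k + j) mod int (p l)" by (rule V(2)[OF F_in_X[OF assms] kj(3)])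
  show ?thesis
    unfolding pos kj(1) C_dvd_add_mod add.assoc[symmetric] by (rule dvd_add_left_iff[OF kj(2)])
qed

lemma F_power:
  assumes "x \<in> X"
  shows "(F ^^ i) x \<in> X \<and> (\<forall>s. C dvd s + position ((F ^^ i) x) \<longleftrightarrow> C dvd s + position x) \<and>
    (F ^^ i) x = (\<lambda>s. if C dvd s + position x then x (s + int i * q) else x s)"
proof (induction i)
  case 0
  then show ?case using assms by simp
next
  case (Suc i)
  let ?y = "(F ^^ i) x"
  have y: "?y \<in> X" "\<And>s. C dvd s + position ?y \<longleftrightarrow> C dvd s + position x"
    "?y = (\<lambda>s. if C dvd s + position x then x (s + int i * q) else x s)"
    using Suc by blast+
  \<comment> \<open>The entry read at \<open>s + q\<close> has already been moved by the first
    \<open>i\<close> steps, because \<open>C\<close> divides \<open>q\<close>; the displacements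
    therefore add up.\<close>
  have "C dvd s + position x + q \<longleftrightarrow> C dvd s + position x" for s
    by (rule dvd_add_left_iff[OF C_dvd_q])
  then have "C dvd s + q + position x \<longleftrightarrow> C dvd s + position x" for s
    by (metis add.commute add.left_commute)
  then have "F ?y s = (if C dvd s + position x then x (s + int (Suc i) * q) else x s)" for s
    unfolding F_apply[OF y(1)] y(2) by (subst (1 2) y(3)) (simp add: algebra_simps)
  then have "(F ^^ Suc i) x = (\<lambda>s. if C dvd s + position x then x (s + int (Suc i) * q) else x s)"
    unfolding funpow.simps comp_apply by (rule ext)
  moreover have "(F ^^ Suc i) x \<in> X" using F_in_X[OF y(1)] by simp
  moreover have "C dvd s + position ((F ^^ Suc i) x) \<longleftrightarrow> C dvd s + position x" for s
    using C_dvd_position_F[OF y(1), of s] y(2)[of s] by simp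
  ultimately show ?case by blast
qed

section \<open>The exact order of \<open>F\<close>\<close>

lemma F_power_C:
  assumes "x \<in> X"
  shows "(F ^^ c l) x = x"
proof
  fix s
  have "x (s + C * q) = x s" if C: "C dvd s + position x"
  proof -
    \<comment> \<open>The window contains both \<open>s\<close> and \<open>s + p l\<close>, so the
      claim is transferred to \<eta> at a multiple of \<open>C\<close>.\<close>
    obtain k where k: "agree (\<bar>s\<bar> + int (p l)) x (shift_by k \<eta>)" "position x = k mod int (p l)"
      using F_approx[OF assms, of "\<bar>s\<bar> + int (p l)"] by blast
    have "x (s + int (p l)) = \<eta> (s + k + int (p l))" "x s = \<eta> (s + k)"
      using agreeD[OF k(1), of "s + int (p l)"] agreeD[OF k(1), of s] by (auto simp: shift_by_def add_ac)
    moreover have "C dvd s + k" using C unfolding k(2) C_dvd_add_mod .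
    ultimately show ?thesis unfolding C_q by (simp only: eta_period_shift)
  qed
  moreover have "(F ^^ c l) x = (\<lambda>s. if C dvd s + position x then x (s + C * q) else x s)"
    using F_power[OF assms, of "c l"] by (elim conjE)
  ultimately show "(F ^^ c l) x s = x s" by simp
qed

lemma F_power_neq:
  assumes "1 \<le> i" "i < c l"
  shows "(F ^^ i) \<eta> \<noteq> \<eta>"
proof
  assume fix_eta: "(F ^^ i) \<eta> = \<eta>"
  have eta: "\<eta> \<in> X" using shift_by_in_orbit_closure[of 0 \<eta>] by simp
  have pos: "position \<eta> = 0" using pi1_is_factor by (simp add: odometer_Delta_def)
  \<comment> \<open>As an element of \<open>B1 N c\<close>, this \<open>s\<close> is not free. It is
    an odd multiple of \<open>2 ^ (l - 1)\<close> and \<open>2 ^ l\<close> divides \<open>q\<close>,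
    so \<open>S l\<close> decides whether \<open>s + i * q\<close> is free.\<close>
  define s where "s = 2 ^ (l - 1) * C\<^sup>2"
  have "C dvd s" by (simp add: s_def power2_eq_square)
  then have "\<eta> (s + int i * q) = \<eta> s"
    using F_power[OF eta, of i] fix_eta pos by (metis add_0_right)
  moreover have "\<not> \<eta> s"
    using mem_S1_l(2) S1_subset_B1 eta_iff by (fastforce simp: s_def)
  moreover have "\<eta> (s + int i * q)"
  proof -
    have lq: "2 ^ l dvd int i * q" using two_power_C_dvd_q by (meson dvd_mult dvd_mult_left)
    have "2 ^ l = (2::int) ^ (l - 1) * 2" using l_ge_1 by (metis One_nat_def Suc_pred less_eq_Suc_le power_Suc2)
    then have "\<not> 2 ^ l dvd s" unfolding s_def using c_odd l_ge_1 by simp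
    then have "\<not> 2 ^ l dvd s + int i * q" using lq by (simp add: dvd_add_left_iff)
    \<comment> \<open>In index \<open>l\<close>, \<open>2 ^ l * c l\<close> is excluded by the power
      of two, and \<open>2 ^ (l - 1) * (c l)\<^sup>2\<close> because \<open>C\<^sup>2\<close>
      divides \<open>s\<close> but not \<open>i * q\<close>. Any other \<open>b\<close> divides
      \<open>i * q\<close>, so it would divide \<open>s\<close>, to which \<open>c k\<close> is
      coprime.\<close>
    moreover have "\<not> int b dvd s + int i * q" if b: "b \<in> S l" for b
    proof
      assume bs: "int b dvd s + int i * q"
      obtain k where k: "1 \<le> k" "k \<le> l" "b = 2 ^ k * c k \<or> b = 2 ^ (k - 1) * (c k)\<^sup>2"
        using b by (rule S1_cases)
      show False
      proof (cases "k = l")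
        case True
        have "b \<noteq> 2 ^ l * c l"
        proof
          assume "b = 2 ^ l * c l"
          then have "2 ^ l dvd int b" by simp
          then show False using bs calculation dvd_trans by blast
        qed
        then have "C\<^sup>2 dvd int b" using k(3) True by auto
        then have "C\<^sup>2 dvd s + int i * q" using bs dvd_trans by blast
        then have "C\<^sup>2 dvd int i * q" unfolding s_def by (simp add: dvd_add_right_iff)
        then have "C dvd int i" by (rule C_square_dvd_q)
        then show False using assms by (auto dest: dvd_imp_le)
      next
        case False
        have "b \<noteq> 2 ^ (l - 1) * (c l)\<^sup>2"
        proof
          assume "b = 2 ^ (l - 1) * (c l)\<^sup>2"
          then have "c k dvd 2 ^ (l - 1) * (c l)\<^sup>2" using k(3) by (auto simp: power2_eq_square)
          moreover have "coprime (c k) (2 ^ (l - 1) * (c l)\<^sup>2)"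
            using c_coprime[OF k(1) l_ge_1 False] c_odd[OF k(1)] by simp
          ultimately have "c k dvd 1" using coprime_absorb_left by blast
          then show False using c_gt_1[OF k(1)] by simp
        qed
        then have "int b dvd int i * q" using S1_l_dvd_q[OF b] by simp
        then have "int b dvd s" using bs by (simp add: dvd_add_left_iff)
        moreover have "int (c k) dvd int b" using k(3) by (auto simp: power2_eq_square)
        ultimately have "int (c k) dvd s" using dvd_trans by blast
        moreover have "coprime (int (c k)) s"
          unfolding s_def using c_coprime_int[OF k(1) l_ge_1 False] c_odd[OF k(1)] by simp
        ultimately have "int (c k) dvd 1" using coprime_absorb_left by blast
        then show False using c_gt_1[OF k(1)] by simp
      qed
    qed
    ultimately show ?thesis using eta_iff_S1 by blast
  qed
  ultimately show False by simp
qed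

section \<open>Continuity, equivariance and invertibility\<close>

lemma continuous_on_F: "continuous_on X F"
proof (intro continuous_on_coordinatewise_then_product continuous_on_if_window)
  fix s x assume x: "x \<in> X"
  obtain V where V: "0 \<le> V" "\<And>x k. x \<in> X \<Longrightarrow> agree V x (shift_by k \<eta>) \<Longrightarrow> position x = k mod int (p l)"
    using position_window by blast
  \<comment> \<open>Radius \<open>V\<close> fixes the position, and \<open>\<bar>s\<bar> + q\<close>
    covers both entries from which the value at \<open>s\<close> may be taken.\<close>
  define W where "W = V + \<bar>s\<bar> + q"
  obtain k where k: "agree W x (shift_by k \<eta>)"
    using x orbit_closure_iff by blast
  have F: "F y s = shift_by k swapped s" if y: "y \<in> X" "agree W y (shift_by k \<eta>)" for y
  proof (rule agreeD[OF F_agree[OF y(1)]])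
    show "position y = k mod int (p l)"
      using V(2)[OF y(1)] agree_mono[OF y(2)] by (simp add: W_def)
    show "agree (\<bar>s\<bar> + q) y (shift_by k \<eta>)"
      using agree_mono[OF y(2)] V(1) by (simp add: W_def)
  qed simp
  have "F y s = F x s" if y: "y \<in> X" "agree W x y" for y
    using F[OF x k] F[OF y(1) agree_trans[OF agree_sym[OF y(2)] k]] by simp
  then show "\<exists>W. \<forall>y\<in>X. agree W x y \<longrightarrow> F y s = F x s" by blast
qed

lemma continuous_on_F_power: "continuous_on X (F ^^ i)"
proof (induction i)
  case (Suc i)
  have "(F ^^ i) ` X \<subseteq> X" using F_power by blast
  then have "continuous_on ((F ^^ i) ` X) F" using continuous_on_F continuous_on_subset by blast
  then show ?case using continuous_on_compose[OF Suc] by simp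
qed (simp add: id_def)

text \<open>Equivariance of the factor map raises the position by \<open>1\<close>, which
  compensates the shift of the coordinate; reduction modulo \<open>p l\<close> is invisible modulo
  \<open>C\<close>.\<close>

lemma F_left_shift:
  assumes x: "x \<in> X"
  shows "F (left_shift x) = left_shift (F x)"
proof
  fix s
  have "pi1 N c (left_shift x) = odometer_add p (odometer_Delta p 1) (pi1 N c x)"
    using pi1_is_factor x by (simp add: factor_map_def)
  then have "position (left_shift x) = (1 + position x) mod int (p l)"
    by (simp add: odometer_add_def odometer_Delta_def mod_simps)
  then show "F (left_shift x) s = left_shift (F x) s"
    using x orbit_closure_shift_by[OF x, of 1]
    by (simp add: F_apply C_dvd_add_mod) (simp add: F_apply shift_by_def add_ac)
qed

lemma F_in_centralizer: "F \<in> centralizer X"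
proof -
  have c: "c l = Suc (c l - 1)" using c_gt_1[OF l_ge_1] by simp
  \<comment> \<open>Since \<open>F ^^ c l\<close> is the identity on \<open>X\<close>, the inverse
    is itself a power of \<open>F\<close> and inherits its continuity.\<close>
  have "homeomorphism X X F (F ^^ (c l - 1))"
  proof (rule homeomorphismI)
    show "continuous_on X F" by (rule continuous_on_F)
    show "continuous_on X (F ^^ (c l - 1))" by (rule continuous_on_F_power)
    show "F ` X \<subseteq> X" using F_in_X by blast
    show "(F ^^ (c l - 1)) ` X \<subseteq> X" using F_power by blast
    fix x assume "x \<in> X"
    then have "(F ^^ Suc (c l - 1)) x = x" using F_power_C c by simp
    then show "F ((F ^^ (c l - 1)) x) = x" "(F ^^ (c l - 1)) (F x) = x"
      by (simp, simp add: funpow_swap1)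
  qed
  moreover have "F \<in> extensional X" by (simp add: F1_def X1_eq)
  ultimately show ?thesis using F_left_shift by (auto simp: centralizer_def)
qed

end

theorem proposition3p23:
  fixes N :: enat and c :: "nat \<Rightarrow> nat" and l :: nat
  assumes "1 \<le> N"
    and "\<And>k. 1 \<le> k \<Longrightarrow> odd (c k) \<and> 1 < c k"
    and "pairwise (\<lambda>j k. coprime (c j) (c k)) {1..}"
    and "1 \<le> l" and "enat l < N"
  shows "F1 N c l \<in> centralizer (X1 N c) \<and>
         (\<forall>x\<in>X1 N c. (F1 N c l ^^ c l) x = x) \<and>
         (\<forall>i. 1 \<le> i \<and> i < c l \<longrightarrow> \<not> (\<forall>x\<in>X1 N c. (F1 N c l ^^ i) x = x))"
proof -
  interpret B1_index N c l
    using assms by unfold_locales (auto simp: pairwise_def)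
  have "\<eta> \<in> X" using shift_by_in_orbit_closure[of 0 \<eta>] by simp
  then show ?thesis
    unfolding X1_eq using F_in_centralizer F_power_C F_power_neq by blast
qed

end
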